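(* Let $d,q\ge 1$ be integers, let $A$ be a real $d\times q$ matrix, let $a\in\mathbb{R}^d$ and let $p\in[2,3)$. Let $\zeta$ be an $\mathbb{R}^q$-valued random vector, defined on a probability space $(\Omega,\mathcal{A},\mathbb{P})$, such that $\mathbb{E}|\zeta|^p<+\infty$ and $\mathbb{E}\,\zeta=0$. (a) For every $h\in(0,+\infty)$, $$\mathbb{E}\,\big|a+\sqrt{h}\,A\zeta\big|^p\le\Big(1+\frac{(p-1)(p-2)}{2}h\Big)|a|^p+h\Big(1+p+h^{\frac p2-1}\Big)\|A\|^p\,\mathbb{E}|\zeta|^p .$$ (b) In particular, let $h\in(0,+\infty)$, $x\in\mathbb{R}^d$ and let $L,\Upsilon\ge 0$ be real constants. If $|a|\le|x|(1+Lh)+Lh$ and $\|A\|^p\le 2^{p-1}\Upsilon^p(1+|x|^p)$, then $$\mathbb{E}\,\big|a+\sqrt{h}\,A\zeta\big|^p\le\big(e^{\kappa_p h}+K_p h\big)|x|^p+\big(e^{\kappa_p h}L+K_p\big)h,$$ where $\kappa_p:=\frac{(p-1)(p-2)}{2}+2pL$ and $K_p:=2^{p-1}\Upsilon^p\big(1+p+h^{\frac p2-1}\big)\mathbb{E}|\zeta|^p$.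
   Context: $|\cdot|$ denotes the canonical Euclidean norm (on $\mathbb{R}^d$ and on $\mathbb{R}^q$), and $\|A\|$ is the Frobenius norm of a matrix: $\|A\|^2=\mathrm{Tr}(AA^\star)$, where $A^\star$ is the transpose of $A$. *)

theory Defs
  imports "HOL-Probability.Probability"
begin

definition frobenius_norm :: "real ^ 'q ^ 'd \<Rightarrow> real" where
  "frobenius_norm A = sqrt (trace (A ** transpose A))"

end

theory Submission imports Defs begin

text \<open>
  For \<open>2 \<le> p \<le> 3\<close> the second-order Taylor expansion of \<open>|\<cdot>|\<^sup>p\<close> at \<open>a\<close> has the remainder \<open>|u|\<^sup>p\<close>
  with constant one. The left-hand side is convex in the cosine of the angle between \<open>a\<close> and \<open>u\<close>
  while the expansion is affine in it, so only the collinear case remains, which is a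
  one-variable inequality. The linear term vanishes in expectation, and Young's inequality
  splits \<open>|a|\<^bsup>p-2\<^esup>|u|\<^sup>2\<close>.

  The growth estimate follows from \<open>1 + s \<le> e\<^sup>s\<close> and the convexity of the \<open>p\<close>-th power, applied to
  \<open>|x|(1 + Lh) + Lh\<close> as \<open>1 + 2Lh\<close> times a convex combination of \<open>|x|\<close> and \<open>1\<close>.
\<close>

section \<open>One-variable power inequalities\<close>

lemma powr_one_plus_le_sublinear:
  fixes t s :: real
  assumes "0 < t" "0 \<le> s" "s \<le> 1"
  shows "(1 + t) powr s \<le> 1 + t powr s"
proof -
  have "(1 + t) powr s = (1 + t) * (1 + t) powr (s - 1)"
    using assms by (simp add: powr_diff)
  then have "(1 + t) powr s = (1 + t) powr (s - 1) + t * (1 + t) powr (s - 1)"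
    by (simp add: algebra_simps)
  \<comment> \<open>Since \<open>s - 1 <= 0\<close>, the power decreases in its base;
    \<open>1 + t\<close> is compared with \<open>1\<close> in the first summand and with
    \<open>t\<close> in the second.\<close>
  moreover have "(1 + t) powr (s - 1) \<le> 1"
    using assms powr_mono2'[of "s - 1" 1 "1 + t"] by simp
  moreover have "t * (1 + t) powr (s - 1) \<le> t * t powr (s - 1)"
    using assms by (intro mult_left_mono powr_mono2') auto
  moreover have "t * t powr (s - 1) = t powr s"
    using assms by (simp add: powr_diff)
  ultimately show ?thesis by linarith
qed

text \<open>Integrates the preceding inequality: the difference of the two sides vanishes at 0, and
  its derivative is \<open>r\<close> times the defect of the sublinear bound at exponent
  \<open>r - 1\<close>.\<close>

lemma powr_one_plus_le_linear:
  fixes t r :: real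
  assumes "0 \<le> t" "1 \<le> r" "r \<le> 2"
  shows "(1 + t) powr r \<le> 1 + r * t + t powr r"
proof -
  define f where "f = (\<lambda>x::real. 1 + r * x + x powr r - (1 + x) powr r)"
  have "f 0 \<le> f t"
  proof (rule DERIV_nonneg_imp_increasing_open[OF assms(1)])
    fix x :: real
    assume x: "0 < x" "x < t"
    have "(f has_real_derivative r * (1 + x powr (r - 1) - (1 + x) powr (r - 1))) (at x)"
      unfolding f_def using x
      by (auto intro!: derivative_eq_intros simp: algebra_simps)
    moreover have "0 \<le> r * (1 + x powr (r - 1) - (1 + x) powr (r - 1))"
      using powr_one_plus_le_sublinear[of x "r - 1"] x assms by simp
    ultimately show "\<exists>y. (f has_real_derivative y) (at x) \<and> y \<ge> 0" by blast
  next
    show "continuous_on {0..t} f"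
      unfolding f_def using assms by (intro continuous_intros continuous_on_powr') auto
  qed
  then show ?thesis using assms by (simp add: f_def)
qed

text \<open>The collinear case with equal directions, by a second integration. Exponents drop from
  [2,3] through [1,2] to [0,1], which is where \<open>p <= 3\<close> enters.\<close>

lemma powr_one_plus_le_quadratic:
  fixes t p :: real
  assumes "0 \<le> t" "2 \<le> p" "p \<le> 3"
  shows "(1 + t) powr p \<le> 1 + p * t + p * (p - 1) / 2 * t\<^sup>2 + t powr p"
proof -
  define f where "f = (\<lambda>x::real. 1 + p * x + p * (p - 1) / 2 * x\<^sup>2 + x powr p - (1 + x) powr p)"
  have "f 0 \<le> f t"
  proof (rule DERIV_nonneg_imp_increasing_open[OF assms(1)])
    fix x :: real
    assume x: "0 < x" "x < t"
    have "(f has_real_derivative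
        p * (1 + (p - 1) * x + x powr (p - 1) - (1 + x) powr (p - 1))) (at x)"
      unfolding f_def using x
      by (auto intro!: derivative_eq_intros simp: field_simps)
    moreover have "0 \<le> p * (1 + (p - 1) * x + x powr (p - 1) - (1 + x) powr (p - 1))"
      using powr_one_plus_le_linear[of x "p - 1"] x assms by simp
    ultimately show "\<exists>y. (f has_real_derivative y) (at x) \<and> y \<ge> 0" by blast
  next
    show "continuous_on {0..t} f"
      unfolding f_def using assms by (intro continuous_intros continuous_on_powr') auto
  qed
  then show ?thesis using assms by (simp add: f_def)
qed

text \<open>Weighted arithmetic-geometric mean of \<open>(1 - t) powr r\<close> and 1 with weights
  \<open>1 / r\<close> and \<open>1 - 1 / r\<close>; the geometric mean is
  \<open>1 - t\<close>.\<close>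

lemma Bernoulli_inequality_powr:
  fixes t r :: real
  assumes "t < 1" "1 \<le> r"
  shows "1 - r * t \<le> (1 - t) powr r"
proof -
  have "((1 - t) powr r) powr (1 / r) * 1 powr (1 - 1 / r)
      \<le> 1 / r * (1 - t) powr r + (1 - 1 / r) * 1"
    using assms by (intro Youngs_inequality_0) auto
  then have "1 - t \<le> 1 / r * (1 - t) powr r + (1 - 1 / r)"
    using assms by (simp add: powr_powr)
  then have "r * (1 - t) \<le> r * (1 / r * (1 - t) powr r + (1 - 1 / r))"
    using assms by (intro mult_left_mono) auto
  then show ?thesis using assms by (simp add: algebra_simps)
qed

lemma powr_one_minus_le_quadratic:
  fixes t p :: real
  assumes "0 \<le> t" "t \<le> 1" "2 \<le> p"
  shows "(1 - t) powr p \<le> 1 - p * t + p * (p - 1) / 2 * t\<^sup>2"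
proof -
  define f where "f = (\<lambda>x::real. 1 - p * x + p * (p - 1) / 2 * x\<^sup>2 - (1 - x) powr p)"
  have "f 0 \<le> f t"
  proof (rule DERIV_nonneg_imp_increasing_open[OF assms(1)])
    fix x :: real
    \<comment> \<open>The open interval keeps \<open>x < 1\<close> even for \<open>t = 1\<close>, as
      differentiability and Bernoulli's inequality require.\<close>
    assume x: "0 < x" "x < t"
    have "(f has_real_derivative p * ((1 - x) powr (p - 1) - (1 - (p - 1) * x))) (at x)"
      unfolding f_def using x assms
      by (auto intro!: derivative_eq_intros simp: field_simps)
    moreover have "0 \<le> p * ((1 - x) powr (p - 1) - (1 - (p - 1) * x))"
      using Bernoulli_inequality_powr[of x "p - 1"] x assms by simp
    ultimately show "\<exists>y. (f has_real_derivative y) (at x) \<and> y \<ge> 0" by blast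
  next
    show "continuous_on {0..t} f"
      unfolding f_def using assms by (intro continuous_intros continuous_on_powr') auto
  qed
  then show ?thesis using assms by (simp add: f_def)
qed

text \<open>The collinear case with opposite directions. Up to \<open>t = 1\<close> the quadratic
  polynomial alone suffices; beyond it \<open>t powr p\<close> alone does, as the polynomial is
  nonnegative.\<close>

lemma powr_abs_one_minus_le_quadratic:
  fixes t p :: real
  assumes "0 \<le> t" "2 \<le> p"
  shows "\<bar>1 - t\<bar> powr p \<le> 1 - p * t + p * (p - 1) / 2 * t\<^sup>2 + t powr p"
proof (cases "t \<le> 1")
  case True
  then show ?thesis using powr_one_minus_le_quadratic[of t p] assms
    by (smt (verit) powr_ge_zero)
next
  case False
  then have "\<bar>1 - t\<bar> powr p \<le> t powr p"
    using assms by (intro powr_mono2) auto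
  moreover have "1 - p * t + p * (p - 1) / 2 * t\<^sup>2 = (1 - p / 2 * t)\<^sup>2 + p * (p - 2) / 4 * t\<^sup>2"
    by (simp add: power2_eq_square field_simps)
  moreover have "0 \<le> p * (p - 2) / 4 * t\<^sup>2" using assms by simp
  ultimately show ?thesis by (smt (verit) zero_le_power2)
qed

section \<open>Expansion of the norm power in an inner product space\<close>

lemma powr_convex_combination:
  fixes x y u v p :: real
  assumes "1 \<le> p" "0 \<le> x" "0 \<le> y" "0 \<le> u" "0 \<le> v" "u + v = 1"
  shows "(u * x + v * y) powr p \<le> u * x powr p + v * y powr p"
proof -
  \<comment> \<open>Covers the endpoint 0, where one summand disappears; \<open>powr_convex\<close>
    handles positive points.\<close>
  have scaled: "(w * z) powr p \<le> w * z powr p" if "0 \<le> w" "w \<le> 1" "0 \<le> z" for w z :: real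
  proof -
    have "w powr p \<le> w"
      using powr_mono'[of 1 p w] that assms by simp
    then show ?thesis using that by (simp add: powr_mult mult_right_mono)
  qed
  consider "x = 0" | "y = 0" | "0 < x" "0 < y" using assms by linarith
  then show ?thesis
  proof cases
    case 3
    then show ?thesis
      using powr_convex[OF assms(1)] assms unfolding convex_on_def by auto
  qed (use scaled[of u x] scaled[of v y] assms in auto)
qed

text \<open>The quadratic coefficient is the one of the collinear case; for nonzero \<open>a\<close>
  it bounds half the second derivative in every direction, so the bound stays affine in the cosine
  \<open>c\<close>.\<close>

lemma norm_add_powr_le:
  fixes a u :: "'a::real_inner" and p :: real
  assumes "2 \<le> p" "p \<le> 3"
  shows "norm (a + u) powr p \<le> norm a powr p + p * norm a powr (p - 2) * (a \<bullet> u)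
    + p * (p - 1) / 2 * norm a powr (p - 2) * (norm u)\<^sup>2 + norm u powr p"
proof (cases "a = 0 \<or> u = 0")
  case True
  \<comment> \<open>For \<open>a = 0\<close> and \<open>p = 2\<close> the quadratic term also
    vanishes, because \<open>0 powr 0 = 0\<close>; the remainder alone then gives equality.\<close>
  then show ?thesis using assms by auto
next
  case False
  define N m t where "N = norm a" and "m = norm u" and "t = norm u / norm a"
  have pos: "0 < N" "0 < m" "0 < t" and m: "m = N * t"
    using False by (auto simp: N_def m_def t_def)
  define c where "c = (a \<bullet> u) / (N * m)"
  have au: "a \<bullet> u = N * m * c" using pos by (simp add: c_def)
  have "\<bar>a \<bullet> u\<bar> \<le> N * m" unfolding N_def m_def by (rule Cauchy_Schwarz_ineq2)
  then have c: "\<bar>c\<bar> \<le> 1" using pos by (simp add: c_def abs_mult)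
  have half: "(x\<^sup>2) powr (p / 2) = \<bar>x\<bar> powr p" for x :: real
    using powr_powr[of "x\<^sup>2" "1 / 2" p] by (simp add: powr_half_sqrt)
  have "(norm (a + u))\<^sup>2 = N\<^sup>2 + 2 * (a \<bullet> u) + m\<^sup>2"
    by (simp add: N_def m_def power2_norm_eq_inner algebra_simps inner_commute)
  \<comment> \<open>With fixed lengths, the squared norm is affine in \<open>c\<close>, so it
    interpolates between its collinear values at \<open>c = 1\<close> and \<open>c = -1\<close>.
    Convexity of the power \<open>p / 2 >= 1\<close> then applies.\<close>
  also have "\<dots> = N\<^sup>2 * ((1 + c) / 2 * (1 + t)\<^sup>2 + (1 - c) / 2 * (1 - t)\<^sup>2)"
    unfolding au m by (simp add: power2_eq_square field_simps)
  finally have sq: "(norm (a + u))\<^sup>2 = \<dots>" .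
  have "norm (a + u) powr p = ((norm (a + u))\<^sup>2) powr (p / 2)"
    by (simp add: half)
  also have "\<dots> = N powr p * ((1 + c) / 2 * (1 + t)\<^sup>2 + (1 - c) / 2 * (1 - t)\<^sup>2) powr (p / 2)"
    unfolding sq using c pos by (subst powr_mult) (auto simp: half)
  also have "\<dots> \<le> N powr p * ((1 + c) / 2 * ((1 + t)\<^sup>2) powr (p / 2) + (1 - c) / 2 * ((1 - t)\<^sup>2) powr (p / 2))"
    using assms c by (intro mult_left_mono powr_convex_combination) (auto simp: field_simps)
  also have "\<dots> = N powr p * ((1 + c) / 2 * (1 + t) powr p + (1 - c) / 2 * \<bar>1 - t\<bar> powr p)"
    using pos by (simp add: half)
  also have "\<dots> \<le> N powr p *
      ((1 + c) / 2 * (1 + p * t + p * (p - 1) / 2 * t\<^sup>2 + t powr p)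
       + (1 - c) / 2 * (1 - p * t + p * (p - 1) / 2 * t\<^sup>2 + t powr p))"
    using c pos assms
    by (intro mult_left_mono add_mono powr_one_plus_le_quadratic powr_abs_one_minus_le_quadratic) auto
  \<comment> \<open>The weights sum to 1 and differ by \<open>c\<close>, so only the linear term
    keeps a trace of the angle.\<close>
  also have "\<dots> = N powr p + p * (N powr p * t * c) + p * (p - 1) / 2 * (N powr p * t\<^sup>2)
      + N powr p * t powr p"
    by (simp add: field_simps)
  also have "N powr p * t * c = N powr (p - 2) * (a \<bullet> u)"
    unfolding au m using pos by (simp add: powr_diff power2_eq_square)
  also have "N powr p * t\<^sup>2 = N powr (p - 2) * m\<^sup>2"
    unfolding m using pos by (simp add: powr_diff power_mult_distrib)
  also have "N powr p * t powr p = m powr p"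
    unfolding m using pos by (simp add: powr_mult)
  finally show ?thesis unfolding N_def m_def by (simp add: mult.assoc)
qed

text \<open>Young's inequality with weights \<open>(p - 2) / p\<close> and \<open>2 / p\<close>,
  multiplied by \<open>p\<close>; the weight form includes \<open>p = 2\<close>.\<close>

lemma Young_powr_diff_square:
  fixes x y p :: real
  assumes "0 \<le> x" "0 \<le> y" "2 \<le> p"
  shows "p * (x powr (p - 2) * y\<^sup>2) \<le> (p - 2) * x powr p + 2 * y powr p"
proof (cases "x = 0 \<or> y = 0")
  case True
  then show ?thesis using assms by auto
next
  case False
  have "(x powr p) powr ((p - 2) / p) * (y powr p) powr (2 / p)
      \<le> (p - 2) / p * x powr p + 2 / p * y powr p"
    using False assms by (intro Youngs_inequality_0) (auto simp: field_simps)
  then have "x powr (p - 2) * y\<^sup>2 \<le> ((p - 2) * x powr p + 2 * y powr p) / p"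
    using False assms by (simp add: powr_powr add_divide_distrib)
  then show ?thesis using assms by (simp add: pos_le_divide_eq mult.commute)
qed

text \<open>The quadratic term scales by \<open>h\<close> and the remainder by
  \<open>h powr (p / 2)\<close>. Young's inequality sends the quadratic term partly to
  \<open>norm a powr p\<close> and partly, with factor \<open>(p - 1) * h\<close>, to
  \<open>norm v powr p\<close>.\<close>

lemma norm_add_scaled_powr_le:
  fixes a v :: "'a::real_inner" and p h :: real
  assumes "2 \<le> p" "p \<le> 3" "0 < h"
  shows "norm (a + sqrt h *\<^sub>R v) powr p \<le> (1 + (p - 1) * (p - 2) / 2 * h) * norm a powr p
    + p * norm a powr (p - 2) * sqrt h * (a \<bullet> v)
    + h * (p - 1 + h powr (p / 2 - 1)) * norm v powr p"
proof -
  have "sqrt h powr p = h powr (p / 2)"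
    using assms by (simp add: powr_powr flip: powr_half_sqrt)
  also have "\<dots> = h * h powr (p / 2 - 1)"
    using assms by (simp add: powr_diff)
  finally have hp: "sqrt h powr p = h * h powr (p / 2 - 1)" .
  have "(p - 1) / 2 * h * (p * (norm a powr (p - 2) * (norm v)\<^sup>2))
      \<le> (p - 1) / 2 * h * ((p - 2) * norm a powr p + 2 * norm v powr p)"
    using assms by (intro mult_left_mono Young_powr_diff_square) auto
  moreover have "norm (a + sqrt h *\<^sub>R v) powr p \<le> norm a powr p
    + p * norm a powr (p - 2) * sqrt h * (a \<bullet> v)
    + (p - 1) / 2 * h * (p * (norm a powr (p - 2) * (norm v)\<^sup>2))
    + h * h powr (p / 2 - 1) * norm v powr p"
    using norm_add_powr_le[OF assms(1,2), of a "sqrt h *\<^sub>R v"] assms(3)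
    by (simp add: power_mult_distrib powr_mult hp mult_ac)
  ultimately show ?thesis by (simp add: field_simps)
qed

section \<open>Matrix norm and passage to expectations\<close>

lemma norm_matrix_vector_mult_le_frobenius:
  fixes A :: "real ^ 'q ^ 'd" and z :: "real ^ 'q"
  shows "norm (A *v z) \<le> frobenius_norm A * norm z"
proof -
  have fro: "frobenius_norm A = sqrt (\<Sum>i\<in>UNIV. (norm (A $ i))\<^sup>2)"
    by (simp add: frobenius_norm_def trace_def matrix_matrix_mult_def
        Finite_Cartesian_Product.transpose_def power2_norm_eq_inner inner_vec_def)
  have "(norm (A *v z))\<^sup>2 = (\<Sum>i\<in>UNIV. (A $ i \<bullet> z)\<^sup>2)"
    unfolding power2_norm_eq_inner inner_vec_def[of "A *v z"]
    by (simp add: matrix_vector_mul_component power2_eq_square)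
  \<comment> \<open>Cauchy-Schwarz row by row; the squared row norms add up to the squared Frobenius
    norm.\<close>
  also have "\<dots> \<le> (\<Sum>i\<in>UNIV. (norm (A $ i))\<^sup>2 * (norm z)\<^sup>2)"
    using Cauchy_Schwarz_ineq by (intro sum_mono) (simp add: power2_norm_eq_inner)
  also have "\<dots> = (frobenius_norm A * norm z)\<^sup>2"
    by (simp add: fro power_mult_distrib sum_nonneg sum_distrib_right)
  finally show ?thesis
    by (rule power2_le_imp_le) (simp add: fro sum_nonneg)
qed

lemma (in finite_measure) integrable_if_integrable_norm_powr:
  fixes f :: "'a \<Rightarrow> 'b::{banach, second_countable_topology}" and p :: real
  assumes "f \<in> borel_measurable M" "1 \<le> p" "integrable M (\<lambda>x. norm (f x) powr p)"
  shows "integrable M f"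
proof (rule Bochner_Integration.integrable_bound)
  show "integrable M (\<lambda>x. 1 + norm (f x) powr p)" using assms by simp
  have "norm (f x) \<le> 1 + norm (f x) powr p" for x
    using powr_mono[of 1 p "norm (f x)"] assms(2)
    by (cases "norm (f x) \<le> 1") (auto intro: add_increasing2)
  then show "AE x in M. norm (f x) \<le> norm (1 + norm (f x) powr p)" by simp
qed fact

lemma (in prob_space) expectation_norm_add_scaled_powr_le:
  fixes A :: "real ^ 'q ^ 'd" and a :: "real ^ 'd" and p h :: real
    and \<zeta> :: "'a \<Rightarrow> real ^ 'q"
  assumes p: "2 \<le> p" "p \<le> 3" and meas: "\<zeta> \<in> borel_measurable M"
    and int: "integrable M (\<lambda>\<omega>. norm (\<zeta> \<omega>) powr p)"
    and mean: "expectation \<zeta> = 0" and h: "0 < h"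
  shows "integrable M (\<lambda>\<omega>. norm (a + sqrt h *\<^sub>R (A *v \<zeta> \<omega>)) powr p)" (is "integrable M ?X")
    and "expectation (\<lambda>\<omega>. norm (a + sqrt h *\<^sub>R (A *v \<zeta> \<omega>)) powr p)
      \<le> (1 + (p - 1) * (p - 2) / 2 * h) * norm a powr p
        + h * (p - 1 + h powr (p / 2 - 1)) * frobenius_norm A powr p
          * expectation (\<lambda>\<omega>. norm (\<zeta> \<omega>) powr p)"
proof -
  let ?F = "frobenius_norm A powr p"
  let ?C = "(1 + (p - 1) * (p - 2) / 2 * h) * norm a powr p"
  let ?D = "h * (p - 1 + h powr (p / 2 - 1))"
  let ?E = "p * norm a powr (p - 2) * sqrt h"
  \<comment> \<open>A pointwise majorant of the integrand that yields both integrability and the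
    bound.\<close>
  define Y where "Y = (\<lambda>\<omega>. ?C + ?E * (a \<bullet> (A *v \<zeta> \<omega>)) + ?D * ?F * norm (\<zeta> \<omega>) powr p)"
  \<comment> \<open>A non-integrable function has integral 0 by convention, so integrability must be
    secured before the zero mean can be moved through the linear functional.\<close>
  have int\<zeta>: "integrable M \<zeta>"
    using p by (intro integrable_if_integrable_norm_powr[OF meas _ int]) auto
  have bl: "bounded_linear (\<lambda>z. a \<bullet> (A *v z))"
    by (intro bounded_linear_compose[OF bounded_linear_inner_right] matrix_vector_mul_bounded_linear)
  have intl: "integrable M (\<lambda>\<omega>. a \<bullet> (A *v \<zeta> \<omega>))"
    by (rule integrable_bounded_linear[OF bl int\<zeta>])
  have El: "expectation (\<lambda>\<omega>. a \<bullet> (A *v \<zeta> \<omega>)) = 0"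
    using integral_bounded_linear[OF bl int\<zeta>] mean by simp
  have le: "?X \<omega> \<le> Y \<omega>" for \<omega>
  proof -
    have "norm (A *v \<zeta> \<omega>) powr p \<le> (frobenius_norm A * norm (\<zeta> \<omega>)) powr p"
      using p by (intro powr_mono2 norm_matrix_vector_mult_le_frobenius) auto
    also have "\<dots> = ?F * norm (\<zeta> \<omega>) powr p"
      by (simp add: powr_mult)
    finally have "?D * norm (A *v \<zeta> \<omega>) powr p \<le> ?D * (?F * norm (\<zeta> \<omega>) powr p)"
      using p h by (intro mult_left_mono) auto
    then show ?thesis
      using norm_add_scaled_powr_le[OF p h, of a "A *v \<zeta> \<omega>"] unfolding Y_def by (simp add: mult.assoc)
  qed
  have intY: "integrable M Y" unfolding Y_def using intl int by simp
  have "(\<lambda>\<omega>. A *v \<zeta> \<omega>) \<in> borel_measurable M"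
    by (intro borel_measurable_integrable integrable_bounded_linear[OF _ int\<zeta>] matrix_vector_mul_bounded_linear)
  then have "?X \<in> borel_measurable M" by measurable
  moreover have "norm (?X \<omega>) \<le> norm (Y \<omega>)" for \<omega>
    using le[of \<omega>] by (smt (verit) powr_ge_zero real_norm_def)
  ultimately show intX: "integrable M ?X"
    by (intro Bochner_Integration.integrable_bound[OF intY]) auto
  have "expectation ?X \<le> expectation Y" by (intro integral_mono intX intY le)
  also have "expectation Y = ?C + ?D * ?F * expectation (\<lambda>\<omega>. norm (\<zeta> \<omega>) powr p)"
    unfolding Y_def using intl int by (simp add: El prob_space)
  finally show "expectation ?X \<le> ?C + ?D * ?F * expectation (\<lambda>\<omega>. norm (\<zeta> \<omega>) powr p)" .
qed

section \<open>Growth estimate and conclusion\<close>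

lemma powr_affine_growth_le:
  fixes x b l p :: real
  assumes "0 \<le> x" "0 \<le> l" "1 \<le> p" "0 \<le> b" "b \<le> x * (1 + l) + l"
  shows "b powr p \<le> exp (2 * p * l) * (x powr p + l)"
proof -
  \<comment> \<open>The sum of the coefficients \<open>1 + l\<close> and \<open>l\<close>; dividing
    by it turns them into convex weights.\<close>
  define q where "q = 1 + 2 * l"
  have q: "1 \<le> q" using assms by (simp add: q_def)
  have eq: "q * ((1 + l) / q * x + l / q * 1) = x * (1 + l) + l"
    using q by (simp add: field_simps)
  have "b powr p \<le> (q * ((1 + l) / q * x + l / q * 1)) powr p"
    unfolding eq using assms by (intro powr_mono2) auto
  also have "\<dots> = q powr p * ((1 + l) / q * x + l / q * 1) powr p"
    using assms q by (intro powr_mult)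
  also have "\<dots> \<le> q powr p * ((1 + l) / q * x powr p + l / q * 1 powr p)"
  proof (intro mult_left_mono powr_convex_combination)
    show "(1 + l) / q + l / q = 1" using q by (simp add: q_def flip: add_divide_distrib)
  qed (use assms q in auto)
  \<comment> \<open>Uses \<open>(1 + l) / q <= 1\<close> and \<open>l / q <= l\<close>; the factor
    \<open>q powr p\<close> is kept for the exponential.\<close>
  also have "\<dots> \<le> q powr p * (1 * x powr p + l)"
    using assms q by (intro mult_left_mono add_mono mult_right_mono) (auto simp: q_def field_simps)
  also have "\<dots> \<le> exp (2 * l) powr p * (1 * x powr p + l)"
    using assms q exp_ge_add_one_self[of "2 * l"]
    by (intro mult_right_mono powr_mono2) (auto simp: q_def)
  also have "\<dots> = exp (2 * p * l) * (x powr p + l)"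
    by (simp add: powr_def mult_ac)
  finally show ?thesis .
qed

theorem lemma2p1:
  fixes A :: "real ^ 'q ^ 'd" and a :: "real ^ 'd" and p :: real
    and M :: "'w measure" and \<zeta> :: "'w \<Rightarrow> real ^ 'q"
  assumes "2 \<le> p" and "p < 3"
    and "prob_space M"
    and "\<zeta> \<in> borel_measurable M"
    and "integrable M (\<lambda>\<omega>. norm (\<zeta> \<omega>) powr p)"
    and "(\<integral>\<omega>. \<zeta> \<omega> \<partial>M) = 0"
  shows
    "(\<forall>h::real. 0 < h \<longrightarrow>
        integrable M (\<lambda>\<omega>. norm (a + sqrt h *\<^sub>R (A *v \<zeta> \<omega>)) powr p) \<and>
        (\<integral>\<omega>. norm (a + sqrt h *\<^sub>R (A *v \<zeta> \<omega>)) powr p \<partial>M)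
          \<le> (1 + (p - 1) * (p - 2) / 2 * h) * norm a powr p
            + h * (1 + p + h powr (p / 2 - 1)) * frobenius_norm A powr p
              * (\<integral>\<omega>. norm (\<zeta> \<omega>) powr p \<partial>M))
     \<and>
     (\<forall>(h::real) (x :: real ^ 'd) (L::real) (\<Upsilon>::real).
        0 < h \<longrightarrow> 0 \<le> L \<longrightarrow> 0 \<le> \<Upsilon> \<longrightarrow>
        norm a \<le> norm x * (1 + L * h) + L * h \<longrightarrow>
        frobenius_norm A powr p \<le> 2 powr (p - 1) * \<Upsilon> powr p * (1 + norm x powr p) \<longrightarrow>
        (let \<kappa> = (p - 1) * (p - 2) / 2 + 2 * p * L;
             K = 2 powr (p - 1) * \<Upsilon> powr p * (1 + p + h powr (p / 2 - 1))
                   * (\<integral>\<omega>. norm (\<zeta> \<omega>) powr p \<partial>M)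
         in integrable M (\<lambda>\<omega>. norm (a + sqrt h *\<^sub>R (A *v \<zeta> \<omega>)) powr p) \<and>
            (\<integral>\<omega>. norm (a + sqrt h *\<^sub>R (A *v \<zeta> \<omega>)) powr p \<partial>M)
              \<le> (exp (\<kappa> * h) + K * h) * norm x powr p + (exp (\<kappa> * h) * L + K) * h))"
proof -
  interpret prob_space M by fact
  let ?X = "\<lambda>h \<omega>. norm (a + sqrt h *\<^sub>R (A *v \<zeta> \<omega>)) powr p"
  let ?c = "(p - 1) * (p - 2) / 2"
  define Z where "Z = expectation (\<lambda>\<omega>. norm (\<zeta> \<omega>) powr p)"
  have Z: "0 \<le> Z" unfolding Z_def by (simp add: integral_nonneg_AE)
  have "p \<le> 3" using assms by simp
  note moment = expectation_norm_add_scaled_powr_le[OF assms(1) this assms(4-6), folded Z_def]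
  have bound: "expectation (?X h)
      \<le> (1 + ?c * h) * norm a powr p + h * (1 + p + h powr (p / 2 - 1)) * frobenius_norm A powr p * Z"
    if h: "0 < h" for h
  proof -
    \<comment> \<open>The moment bound has the smaller constant \<open>p - 1\<close>, which is
      relaxed to \<open>1 + p\<close>.\<close>
    have "h * (p - 1 + h powr (p / 2 - 1)) * frobenius_norm A powr p * Z
        \<le> h * (1 + p + h powr (p / 2 - 1)) * frobenius_norm A powr p * Z"
      using h Z by (intro mult_right_mono mult_left_mono) auto
    then show ?thesis using moment(2)[OF h, of a A] by linarith
  qed
  have growth: "expectation (?X h)
      \<le> (exp ((?c + 2 * p * L) * h) + K * h) * norm x powr p + (exp ((?c + 2 * p * L) * h) * L + K) * h"
    if h: "0 < h" and L: "0 \<le> L"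
      and a: "norm a \<le> norm x * (1 + L * h) + L * h"
      and A: "frobenius_norm A powr p \<le> 2 powr (p - 1) * \<Upsilon> powr p * (1 + norm x powr p)"
      and K: "K = 2 powr (p - 1) * \<Upsilon> powr p * (1 + p + h powr (p / 2 - 1)) * Z"
    for h L \<Upsilon> K :: real and x :: "real ^ 'd"
  proof -
    \<comment> \<open>The affine growth bound with \<open>l = L * h\<close> supplies the part
      \<open>2 * p * L\<close> of the exponent, and \<open>1 + s <= exp s\<close> supplies
      \<open>?c\<close>.\<close>
    have "(1 + ?c * h) * norm a powr p
        \<le> exp (?c * h) * (exp (2 * p * (L * h)) * (norm x powr p + L * h))"
      using assms(1) h L a by (intro mult_mono powr_affine_growth_le exp_ge_add_one_self) auto
    also have "\<dots> = exp ((?c + 2 * p * L) * h) * (norm x powr p + L * h)"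
      by (simp add: exp_add distrib_right mult.assoc)
    finally have 1: "(1 + ?c * h) * norm a powr p \<le> \<dots>" .
    have "h * (1 + p + h powr (p / 2 - 1)) * frobenius_norm A powr p * Z
        \<le> h * (1 + p + h powr (p / 2 - 1)) * (2 powr (p - 1) * \<Upsilon> powr p * (1 + norm x powr p)) * Z"
      using assms(1) h Z A by (intro mult_right_mono mult_left_mono) auto
    also have "\<dots> = K * h * (1 + norm x powr p)"
      unfolding K by (simp only: mult_ac)
    finally have 2: "h * (1 + p + h powr (p / 2 - 1)) * frobenius_norm A powr p * Z \<le> \<dots>" .
    \<comment> \<open>Naming the exponential keeps its exponent from being expanded in the final
      rearrangement.\<close>
    define e where "e = exp ((?c + 2 * p * L) * h)"
    show ?thesis using bound[OF h] 1 2 unfolding e_def[symmetric] by (simp add: algebra_simps)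
  qed
  show ?thesis
    unfolding Let_def Z_def[symmetric]
    using moment(1) bound growth by blast
qed

end
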